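(* Let $\alpha > -1$ be a real number and let $M \in \mathcal{B}(\ell^2)$ be the generalized Cesàro matrix of order two, i.e. the operator on $\ell^2$ given by the lower triangular matrix $M = [m_{ij}]_{i,j\ge 0}$ with $m_{ij} = \frac{2(i+1-j)}{(i+1+\alpha)(i+2+\alpha)}$ for $0 \le j \le i$ and $m_{ij} = 0$ for $j > i$. Then $M$ is supraposinormal.
   Context: $\ell^2$ is the Hilbert space of square-summable sequences indexed by $\{0,1,2,\dots\}$, and matrices act with respect to its standard orthonormal basis. The matrix $M$ is a bounded operator on $\ell^2$ for every $\alpha > -1$. For a Hilbert space $H$, $\mathcal{B}(H)$ denotes the bounded linear operators on $H$; an operator $T$ is positive if it is self-adjoint and $\langle Tf,f\rangle \ge 0$ for all $f\in H$. An operator $A \in \mathcal{B}(H)$ is supraposinormal if there exist positive operators $P, Q \in \mathcal{B}(H)$ such that $AQA^* = A^*PA$, where at least one of $P$, $Q$ has dense range. *)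

theory Defs
  imports "HOL-Analysis.Analysis" "HOL-Library.Nonpos_Ints"
begin

section \<open>Complex Hilbert spaces and their bounded operators\<close>

text \<open>
  A complex Hilbert space is presented as a complete real inner product space, with a complex
  scalar multiplication extending the real one and a complex inner product, linear in the first
  argument, whose real part is the given real inner product. Positive definiteness and
  \<open>norm x = sqrt \<langle>x, x\<rangle>\<close> are inherited from the real structure.
\<close>

class chilbert_space = real_inner + complete_space +
  fixes scaleC :: "complex \<Rightarrow> 'a \<Rightarrow> 'a"  (infixr \<open>*\<^sub>C\<close> 75)
    and cinner :: "'a \<Rightarrow> 'a \<Rightarrow> complex"
  assumes scaleC_add_right: "c *\<^sub>C (x + y) = c *\<^sub>C x + c *\<^sub>C y"
    and scaleC_add_left: "(c + d) *\<^sub>C x = c *\<^sub>C x + d *\<^sub>C x"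
    and scaleC_scaleC: "c *\<^sub>C d *\<^sub>C x = (c * d) *\<^sub>C x"
    and scaleC_of_real: "complex_of_real r *\<^sub>C x = r *\<^sub>R x"
    and cinner_commute: "cinner x y = cnj (cinner y x)"
    and cinner_add_left: "cinner (x + y) z = cinner x z + cinner y z"
    and cinner_scaleC_left: "cinner (c *\<^sub>C x) y = c * cinner x y"
    and Re_cinner: "Re (cinner x y) = inner x y"

definition bounded_clinear :: "('a::chilbert_space \<Rightarrow> 'b::chilbert_space) \<Rightarrow> bool" where
  "bounded_clinear T \<longleftrightarrow> bounded_linear T \<and> (\<forall>c x. T (c *\<^sub>C x) = c *\<^sub>C T x)"

text \<open>By the Riesz representation theorem the description is proper for bounded \<open>T\<close>.\<close>

definition cadjoint :: "('a::chilbert_space \<Rightarrow> 'a) \<Rightarrow> 'a \<Rightarrow> 'a" where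
  "cadjoint T = (THE S. \<forall>x y. cinner (T x) y = cinner x (S y))"

definition positive_op :: "('a::chilbert_space \<Rightarrow> 'a) \<Rightarrow> bool" where
  "positive_op T \<longleftrightarrow>
     bounded_clinear T \<and> cadjoint T = T \<and> (\<forall>f. cinner (T f) f \<in> \<real>\<^sub>\<ge>\<^sub>0)"

definition dense_range :: "('a \<Rightarrow> 'b::topological_space) \<Rightarrow> bool" where
  "dense_range T \<longleftrightarrow> closure (range T) = UNIV"

definition supraposinormal :: "('a::chilbert_space \<Rightarrow> 'a) \<Rightarrow> bool" where
  "supraposinormal A \<longleftrightarrow>
     bounded_clinear A \<and>
     (\<exists>P Q. positive_op P \<and> positive_op Q \<and> (dense_range P \<or> dense_range Q) \<and>
            A \<circ> Q \<circ> cadjoint A = cadjoint A \<circ> P \<circ> A)"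

lemma cadjoint_eqI:
  assumes "\<And>x y. cinner (T x) y = cinner x (S y)"
  shows "cadjoint T = S"
  unfolding cadjoint_def
proof (rule the_equality)
  fix S' assume S': "\<forall>x y. cinner (T x) y = cinner x (S' y)"
  show "S' = S"
  proof
    fix y
    have "inner x (S' y) = inner x (S y)" for x
      using assms[of x y] S' by (metis Re_cinner)
    then show "S' y = S y"
      by (metis vector_eq_ldot)
  qed
qed (use assms in blast)


section \<open>The Hilbert space of square-summable sequences\<close>

typedef ell2 = "{f :: nat \<Rightarrow> complex. summable (\<lambda>n. (norm (f n))\<^sup>2)}"
  by (rule exI[of _ "\<lambda>_. 0"]) simp

setup_lifting type_definition_ell2

lemma summable_ell2: "summable (\<lambda>n. (norm (Rep_ell2 f n))\<^sup>2)"
  using Rep_ell2 by blast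

lemma square_summable_add:
  fixes f g :: "nat \<Rightarrow> complex"
  assumes "summable (\<lambda>n. (norm (f n))\<^sup>2)" "summable (\<lambda>n. (norm (g n))\<^sup>2)"
  shows "summable (\<lambda>n. (norm (f n + g n))\<^sup>2)"
proof (rule summable_comparison_test')
  show "summable (\<lambda>n. 2 * (norm (f n))\<^sup>2 + 2 * (norm (g n))\<^sup>2)"
    by (intro summable_add summable_mult assms)
  show "norm ((norm (f n + g n))\<^sup>2) \<le> 2 * (norm (f n))\<^sup>2 + 2 * (norm (g n))\<^sup>2" if "n \<ge> 0" for n
  proof -
    have "(norm (f n + g n))\<^sup>2 \<le> (norm (f n) + norm (g n))\<^sup>2"
      by (intro power_mono norm_triangle_ineq) simp
    also have "\<dots> \<le> 2 * (norm (f n))\<^sup>2 + 2 * (norm (g n))\<^sup>2"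
      using sum_squares_bound[of "norm (f n)" "norm (g n)"] by (simp add: power2_sum)
    finally show ?thesis by simp
  qed
qed

lemma square_summable_scale:
  fixes f :: "nat \<Rightarrow> complex"
  assumes "summable (\<lambda>n. (norm (f n))\<^sup>2)"
  shows "summable (\<lambda>n. (norm (c * f n))\<^sup>2)"
  using summable_mult[OF assms, of "(norm c)\<^sup>2"] by (simp add: norm_mult power_mult_distrib)

lemma square_summable_prod:
  fixes f g :: "nat \<Rightarrow> complex"
  assumes "summable (\<lambda>n. (norm (f n))\<^sup>2)" "summable (\<lambda>n. (norm (g n))\<^sup>2)"
  shows "summable (\<lambda>n. f n * cnj (g n))"
proof (rule summable_comparison_test')
  show "summable (\<lambda>n. (norm (f n))\<^sup>2 + (norm (g n))\<^sup>2)"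
    by (intro summable_add assms)
  show "norm (f n * cnj (g n)) \<le> (norm (f n))\<^sup>2 + (norm (g n))\<^sup>2" if "n \<ge> 0" for n
    using sum_squares_bound[of "norm (f n)" "norm (g n)"]
      mult_nonneg_nonneg[OF norm_ge_zero[of "f n"] norm_ge_zero[of "g n"]]
    unfolding norm_mult complex_mod_cnj by linarith
qed

lemma suminf_norm_square:
  fixes f :: "nat \<Rightarrow> complex"
  assumes "summable (\<lambda>n. (norm (f n))\<^sup>2)"
  shows "(\<Sum>n. f n * cnj (f n)) = complex_of_real (\<Sum>n. (norm (f n))\<^sup>2)"
  unfolding suminf_of_real[OF assms, symmetric] complex_norm_square[symmetric] ..

instantiation ell2 :: real_inner
begin

lift_definition zero_ell2 :: ell2 is "\<lambda>_. 0" by simp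

lift_definition plus_ell2 :: "ell2 \<Rightarrow> ell2 \<Rightarrow> ell2" is "\<lambda>f g n. f n + g n"
  by (rule square_summable_add)

lift_definition uminus_ell2 :: "ell2 \<Rightarrow> ell2" is "\<lambda>f n. - f n" by simp

definition minus_ell2 :: "ell2 \<Rightarrow> ell2 \<Rightarrow> ell2" where
  "minus_ell2 f g = f + (- g)"

lift_definition scaleR_ell2 :: "real \<Rightarrow> ell2 \<Rightarrow> ell2" is "\<lambda>r f n. complex_of_real r * f n"
  by (rule square_summable_scale)

lift_definition inner_ell2 :: "ell2 \<Rightarrow> ell2 \<Rightarrow> real" is
  "\<lambda>f g. Re (\<Sum>n. f n * cnj (g n))" .

definition norm_ell2 :: "ell2 \<Rightarrow> real" where
  "norm_ell2 f = sqrt (inner f f)"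

definition sgn_ell2 :: "ell2 \<Rightarrow> ell2" where
  "sgn_ell2 f = inverse (norm f) *\<^sub>R f"

definition dist_ell2 :: "ell2 \<Rightarrow> ell2 \<Rightarrow> real" where
  "dist_ell2 f g = norm (f - g)"

definition uniformity_ell2 :: "(ell2 \<times> ell2) filter" where
  "uniformity_ell2 = (INF e\<in>{0<..}. principal {(x, y). dist x y < e})"

definition open_ell2 :: "ell2 set \<Rightarrow> bool" where
  "open_ell2 U \<longleftrightarrow> (\<forall>x\<in>U. \<forall>\<^sub>F (x', y) in uniformity. x' = x \<longrightarrow> y \<in> U)"

instance
proof
  fix x y z :: ell2 and r s :: real
  show "x + y + z = x + (y + z)" by transfer (simp add: add.assoc)
  show "x + y = y + x" by transfer (simp add: add.commute)
  show "0 + x = x" by transfer simp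
  show "- x + x = 0" by transfer simp
  show "x - y = x + - y" by (rule minus_ell2_def)
  show "r *\<^sub>R (x + y) = r *\<^sub>R x + r *\<^sub>R y" by transfer (simp add: algebra_simps)
  show "(r + s) *\<^sub>R x = r *\<^sub>R x + s *\<^sub>R x" by transfer (simp add: algebra_simps)
  show "r *\<^sub>R s *\<^sub>R x = (r * s) *\<^sub>R x" by transfer (simp add: algebra_simps)
  show "1 *\<^sub>R x = x" by transfer simp
  show "sgn x = inverse (norm x) *\<^sub>R x" by (rule sgn_ell2_def)
  show "dist x y = norm (x - y)" by (rule dist_ell2_def)
  show "uniformity = (INF e\<in>{0<..}. principal {(x::ell2, y). dist x y < e})"
    by (rule uniformity_ell2_def)
  show "open U = (\<forall>x\<in>U. \<forall>\<^sub>F (x', y) in uniformity. x' = x \<longrightarrow> y \<in> U)" for U :: "ell2 set"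
    by (rule open_ell2_def)
  show "norm x = sqrt (inner x x)" by (rule norm_ell2_def)
  show "inner x y = inner y x"
  proof transfer
    fix f g :: "nat \<Rightarrow> complex"
    assume "summable (\<lambda>n. (norm (f n))\<^sup>2)" "summable (\<lambda>n. (norm (g n))\<^sup>2)"
    then have fg: "summable (\<lambda>n. f n * cnj (g n))" by (rule square_summable_prod)
    have "(\<lambda>n. cnj (f n * cnj (g n))) sums cnj (\<Sum>n. f n * cnj (g n))"
      using fg by (simp only: sums_cnj summable_sums)
    then have "(\<Sum>n. g n * cnj (f n)) = cnj (\<Sum>n. f n * cnj (g n))"
      by (simp add: sums_iff mult.commute)
    then show "Re (\<Sum>n. f n * cnj (g n)) = Re (\<Sum>n. g n * cnj (f n))" by simp
  qed
  show "inner (x + y) z = inner x z + inner y z"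
    by transfer (simp add: distrib_right square_summable_prod flip: suminf_add)
  show "inner (r *\<^sub>R x) y = r * inner x y"
    by transfer (simp add: mult.assoc suminf_mult square_summable_prod)
  have sq: "inner x x = (\<Sum>n. (norm (Rep_ell2 x n))\<^sup>2)"
    by (simp only: inner_ell2.rep_eq suminf_norm_square[OF summable_ell2] Re_complex_of_real)
  then show "0 \<le> inner x x"
    by (simp add: suminf_nonneg summable_ell2)
  show "inner x x = 0 \<longleftrightarrow> x = 0"
  proof
    assume "inner x x = 0"
    then have "\<forall>n. Rep_ell2 x n = 0"
      using sq summable_ell2[of x] by (simp add: suminf_eq_zero_iff)
    then show "x = 0" by transfer auto
  qed (transfer, simp)
qed

end

lemma norm_ell2_square: "(norm f)\<^sup>2 = (\<Sum>n. (norm (Rep_ell2 f n))\<^sup>2)" for f :: ell2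
  by (simp only: power2_norm_eq_inner inner_ell2.rep_eq suminf_norm_square[OF summable_ell2]
      Re_complex_of_real)

lemma Rep_ell2_diff: "Rep_ell2 (f - g) n = Rep_ell2 f n - Rep_ell2 g n"
  by (simp add: minus_ell2_def plus_ell2.rep_eq uminus_ell2.rep_eq del: add_uminus_conv_diff)

lemma sum_le_norm_ell2: "(\<Sum>i<n. (norm (Rep_ell2 f i))\<^sup>2) \<le> (norm f)\<^sup>2"
  unfolding norm_ell2_square by (rule sum_le_suminf) (simp_all add: summable_ell2)

lemma coord_le_norm_ell2: "norm (Rep_ell2 f n) \<le> norm f"
proof (rule power2_le_imp_le)
  have "(norm (Rep_ell2 f n))\<^sup>2 \<le> (\<Sum>i<Suc n. (norm (Rep_ell2 f i))\<^sup>2)"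
    by (simp add: sum_nonneg)
  also have "\<dots> \<le> (norm f)\<^sup>2" by (rule sum_le_norm_ell2)
  finally show "(norm (Rep_ell2 f n))\<^sup>2 \<le> (norm f)\<^sup>2" .
qed simp

instance ell2 :: complete_space
proof
  fix X :: "nat \<Rightarrow> ell2" assume X: "Cauchy X"
  define f where "f = (\<lambda>i. lim (\<lambda>m. Rep_ell2 (X m) i))"
  have lim: "(\<lambda>m. Rep_ell2 (X m) i) \<longlonglongrightarrow> f i" for i
  proof -
    have "Cauchy (\<lambda>m. Rep_ell2 (X m) i)"
    proof (rule metric_CauchyI)
      fix e :: real assume "e > 0"
      then obtain N where N: "\<forall>m\<ge>N. \<forall>n\<ge>N. dist (X m) (X n) < e"
        using metric_CauchyD[OF X] by blast
      have "dist (Rep_ell2 (X m) i) (Rep_ell2 (X n) i) \<le> dist (X m) (X n)" for m n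
        using coord_le_norm_ell2[of "X m - X n" i] by (simp add: dist_norm Rep_ell2_diff)
      with N show "\<exists>N. \<forall>m\<ge>N. \<forall>n\<ge>N. dist (Rep_ell2 (X m) i) (Rep_ell2 (X n) i) < e"
        by (meson le_less_trans)
    qed
    then show ?thesis
      by (simp add: f_def Cauchy_convergent_iff convergent_LIMSEQ_iff)
  qed
  have bound: "(\<Sum>i<n. (norm (Rep_ell2 (X m) i - f i))\<^sup>2) \<le> e\<^sup>2"
    if "m \<ge> N" "\<forall>m\<ge>N. \<forall>n\<ge>N. dist (X m) (X n) < e" for m N n and e :: real
  proof (rule LIMSEQ_le_const2)
    show "(\<lambda>k. \<Sum>i<n. (norm (Rep_ell2 (X m) i - Rep_ell2 (X k) i))\<^sup>2)
            \<longlonglongrightarrow> (\<Sum>i<n. (norm (Rep_ell2 (X m) i - f i))\<^sup>2)"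
      by (intro tendsto_intros lim)
    have "(\<Sum>i<n. (norm (Rep_ell2 (X m) i - Rep_ell2 (X k) i))\<^sup>2) \<le> e\<^sup>2" if "k \<ge> N" for k
    proof -
      have "(\<Sum>i<n. (norm (Rep_ell2 (X m) i - Rep_ell2 (X k) i))\<^sup>2) \<le> (norm (X m - X k))\<^sup>2"
        using sum_le_norm_ell2[of "X m - X k" n] by (simp add: Rep_ell2_diff)
      also have "\<dots> \<le> e\<^sup>2"
        using that \<open>m \<ge> N\<close> \<open>\<forall>m\<ge>N. _ m\<close> by (intro power_mono) (auto simp: dist_norm less_imp_le)
      finally show ?thesis .
    qed
    then show "\<exists>N. \<forall>k\<ge>N. (\<Sum>i<n. (norm (Rep_ell2 (X m) i - Rep_ell2 (X k) i))\<^sup>2) \<le> e\<^sup>2"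
      by blast
  qed
  have summ: "summable (\<lambda>i. (norm (Rep_ell2 (X m) i - f i))\<^sup>2)"
    if "m \<ge> N" "\<forall>m\<ge>N. \<forall>n\<ge>N. dist (X m) (X n) < e" for m N and e :: real
    by (rule bounded_imp_summable[where B = "e\<^sup>2"])
       (use bound[OF that, of "Suc _"] in \<open>simp_all add: lessThan_Suc_atMost\<close>)
  have f: "summable (\<lambda>i. (norm (f i))\<^sup>2)"
  proof -
    obtain N where N: "\<forall>m\<ge>N. \<forall>n\<ge>N. dist (X m) (X n) < 1"
      using metric_CauchyD[OF X, of 1] by auto
    have "summable (\<lambda>i. (norm (-1 * (Rep_ell2 (X N) i - f i)))\<^sup>2)"
      by (rule square_summable_scale, rule summ[OF order_refl N])
    from square_summable_add[OF summable_ell2[of "X N"] this] show ?thesis by simp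
  qed
  then have Rep: "Rep_ell2 (Abs_ell2 f) = f"
    by (simp add: Abs_ell2_inverse)
  have "X \<longlonglongrightarrow> Abs_ell2 f"
  proof (rule metric_LIMSEQ_I)
    fix e :: real assume "e > 0"
    then obtain N where N: "\<forall>m\<ge>N. \<forall>n\<ge>N. dist (X m) (X n) < e / 2"
      using metric_CauchyD[OF X, of "e / 2"] by auto
    have "dist (X m) (Abs_ell2 f) < e" if "m \<ge> N" for m
    proof -
      have "(norm (X m - Abs_ell2 f))\<^sup>2 \<le> (e / 2)\<^sup>2"
        unfolding norm_ell2_square Rep_ell2_diff Rep
        by (rule suminf_le_const[OF summ[OF that N] bound[OF that N]])
      then have "norm (X m - Abs_ell2 f) \<le> e / 2"
        by (rule power2_le_imp_le) (use \<open>e > 0\<close> in simp)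
      then show ?thesis using \<open>e > 0\<close> by (simp add: dist_norm)
    qed
    then show "\<exists>N. \<forall>m\<ge>N. dist (X m) (Abs_ell2 f) < e" by blast
  qed
  then show "convergent X" by (auto simp: convergent_def)
qed

instantiation ell2 :: chilbert_space
begin

lift_definition scaleC_ell2 :: "complex \<Rightarrow> ell2 \<Rightarrow> ell2" is "\<lambda>c f n. c * f n"
  by (rule square_summable_scale)

lift_definition cinner_ell2 :: "ell2 \<Rightarrow> ell2 \<Rightarrow> complex" is "\<lambda>f g. \<Sum>n. f n * cnj (g n)" .

instance
proof
  fix x y z :: ell2 and c d :: complex and r :: real
  show "c *\<^sub>C (x + y) = c *\<^sub>C x + c *\<^sub>C y" by transfer (simp add: algebra_simps)
  show "(c + d) *\<^sub>C x = c *\<^sub>C x + d *\<^sub>C x" by transfer (simp add: algebra_simps)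
  show "c *\<^sub>C d *\<^sub>C x = (c * d) *\<^sub>C x" by transfer (simp add: algebra_simps)
  show "complex_of_real r *\<^sub>C x = r *\<^sub>R x" by transfer simp
  show "cinner x y = cnj (cinner y x)"
  proof transfer
    fix f g :: "nat \<Rightarrow> complex"
    assume "summable (\<lambda>n. (norm (f n))\<^sup>2)" "summable (\<lambda>n. (norm (g n))\<^sup>2)"
    then have "summable (\<lambda>n. g n * cnj (f n))" by (simp add: square_summable_prod)
    then have "(\<lambda>n. cnj (g n * cnj (f n))) sums cnj (\<Sum>n. g n * cnj (f n))"
      by (simp only: sums_cnj summable_sums)
    then show "(\<Sum>n. f n * cnj (g n)) = cnj (\<Sum>n. g n * cnj (f n))"
      by (simp add: sums_iff mult.commute)
  qed
  show "cinner (x + y) z = cinner x z + cinner y z"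
    by transfer (simp add: distrib_right square_summable_prod flip: suminf_add)
  show "cinner (c *\<^sub>C x) y = c * cinner x y"
    by transfer (simp add: mult.assoc suminf_mult square_summable_prod)
  show "Re (cinner x y) = inner x y"
    by transfer simp
qed

end

text \<open>
  The operator with a given matrix with respect to the standard basis. It is meaningful only if
  the sequences on the right-hand side exist and are square-summable.
\<close>

definition matrix_op :: "(nat \<Rightarrow> nat \<Rightarrow> complex) \<Rightarrow> ell2 \<Rightarrow> ell2" where
  "matrix_op m f = Abs_ell2 (\<lambda>i. \<Sum>j. m i j * Rep_ell2 f j)"


section \<open>The generalized Cesaro matrix of order two\<close>

definition gcesaro2_entry :: "real \<Rightarrow> nat \<Rightarrow> nat \<Rightarrow> real" where
  "gcesaro2_entry \<alpha> i j =
     (if j \<le> i then 2 * (real i + 1 - real j) / ((real i + 1 + \<alpha>) * (real i + 2 + \<alpha>)) else 0)"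

definition gcesaro2 :: "real \<Rightarrow> ell2 \<Rightarrow> ell2" where
  "gcesaro2 \<alpha> = matrix_op (\<lambda>i j. complex_of_real (gcesaro2_entry \<alpha> i j))"

text \<open>
  Boundedness, so that the value of \<^const>\<open>Abs_ell2\<close> above is the intended one: the entries are
  dominated by a multiple of those of the Cesaro matrix, to which Hardy's inequality applies.
\<close>

lemma hardy_sum:
  fixes x :: "nat \<Rightarrow> real"
  defines "a \<equiv> \<lambda>n. (\<Sum>j\<le>n. x j) / (real n + 1)"
  shows "(\<Sum>i<n. (a i)\<^sup>2) \<le> 4 * (\<Sum>i<n. (x i)\<^sup>2)"
proof -
  have tele: "(\<Sum>i<n. (a i)\<^sup>2 - 2 * a i * x i) \<le> - real n * (if n = 0 then 0 else (a (n - 1))\<^sup>2)" for n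
  proof (induction n)
    case (Suc n)
    show ?case
    proof (cases n)
      case 0
      then show ?thesis by (simp add: a_def power2_eq_square)
    next
      case (Suc k)
      have x: "x n = (real n + 1) * a n - real n * a k"
      proof -
        have "(real n + 1) * a n = (\<Sum>j\<le>n. x j)" "real n * a k = (\<Sum>j\<le>k. x j)"
          unfolding a_def Suc by (simp_all add: add.commute[of "real k" 1] del: sum.atMost_Suc)
        then show ?thesis unfolding Suc by simp
      qed
      have "real n * (2 * a n * a k) \<le> real n * ((a n)\<^sup>2 + (a k)\<^sup>2)"
        using sum_squares_bound[of "a n" "a k"] by (intro mult_left_mono) auto
      moreover have "(\<Sum>i<n. (a i)\<^sup>2 - 2 * a i * x i) \<le> - real n * (a k)\<^sup>2"
        using Suc.IH Suc by simp
      ultimately show ?thesis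
        by (simp add: x algebra_simps power2_eq_square)
    qed
  qed simp
  have "(\<Sum>i<n. (a i)\<^sup>2 - 2 * a i * x i) \<le> 0"
    by (rule order_trans[OF tele]) simp
  moreover
  have "(\<Sum>i<n. (a i)\<^sup>2 - 4 * (x i)\<^sup>2) \<le> (\<Sum>i<n. 2 * ((a i)\<^sup>2 - 2 * a i * x i))"
  proof (rule sum_mono)
    fix i
    have "0 \<le> (a i - 2 * x i)\<^sup>2" by simp
    then show "(a i)\<^sup>2 - 4 * (x i)\<^sup>2 \<le> 2 * ((a i)\<^sup>2 - 2 * a i * x i)"
      by (simp add: power2_eq_square algebra_simps)
  qed
  then have "(\<Sum>i<n. (a i)\<^sup>2) - 4 * (\<Sum>i<n. (x i)\<^sup>2) \<le> 2 * (\<Sum>i<n. (a i)\<^sup>2 - 2 * a i * x i)"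
    by (simp only: sum_subtractf[of "\<lambda>i. (a i)\<^sup>2" "\<lambda>i. 4 * (x i)\<^sup>2"] sum_distrib_left)
  ultimately show ?thesis by linarith
qed

lemma gcesaro2_suminf:
  fixes f :: "nat \<Rightarrow> complex"
  shows "(\<Sum>j. complex_of_real (gcesaro2_entry \<alpha> i j) * f j) = (\<Sum>j\<le>i. gcesaro2_entry \<alpha> i j * f j)"
  by (rule suminf_finite) (auto simp: gcesaro2_entry_def)

lemma gcesaro2_sum_le:
  fixes f :: "nat \<Rightarrow> complex"
  assumes "\<alpha> > -1"
  shows "(\<Sum>i<n. (norm (\<Sum>j\<le>i. gcesaro2_entry \<alpha> i j * f j))\<^sup>2)
           \<le> (4 / min 1 (1 + \<alpha>))\<^sup>2 * (\<Sum>i<n. (norm (f i))\<^sup>2)"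
proof -
  define c where "c = min 1 (1 + \<alpha>)"
  have c: "0 < c" "c \<le> 1" "c \<le> 1 + \<alpha>" using assms by (auto simp: c_def)
  have entry: "0 \<le> gcesaro2_entry \<alpha> i j \<and> gcesaro2_entry \<alpha> i j \<le> 2 / c / (real i + 1)"
    if "j \<le> i" for i j
  proof -
    have "c * real i \<le> 1 * real i" using c by (intro mult_right_mono) auto
    then have 1: "c * (real i + 1) \<le> real i + 1 + \<alpha>" using c by (simp add: algebra_simps)
    have 2: "real i + 1 \<le> real i + 2 + \<alpha>" using assms by simp
    have pos: "0 < c * (real i + 1)" using c by simp
    have prod: "(c * (real i + 1)) * (real i + 1) \<le> (real i + 1 + \<alpha>) * (real i + 2 + \<alpha>)"
      by (rule mult_mono[OF 1 2]) (use 1 pos in linarith)+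
    have "0 < (c * (real i + 1)) * (real i + 1)"
      by (rule mult_pos_pos[OF pos]) simp
    from frac_le[OF _ _ this prod, of "2 * (real i + 1)" "2 * (real i + 1 - real j)"]
    have "2 * (real i + 1 - real j) / ((real i + 1 + \<alpha>) * (real i + 2 + \<alpha>))
        \<le> 2 * (real i + 1) / ((c * (real i + 1)) * (real i + 1))"
      by simp
    also have "\<dots> = 2 / c / (real i + 1)" using c by (simp add: divide_simps)
    finally have "gcesaro2_entry \<alpha> i j \<le> 2 / c / (real i + 1)"
      using that by (simp add: gcesaro2_entry_def)
    moreover have "0 \<le> gcesaro2_entry \<alpha> i j"
      using that 1 2 pos by (simp add: gcesaro2_entry_def)
    ultimately show ?thesis by simp
  qed
  have "(norm (\<Sum>j\<le>i. gcesaro2_entry \<alpha> i j * f j))\<^sup>2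
      \<le> (2 / c)\<^sup>2 * ((\<Sum>j\<le>i. norm (f j)) / (real i + 1))\<^sup>2" for i
  proof -
    have "norm (\<Sum>j\<le>i. gcesaro2_entry \<alpha> i j * f j) \<le> (\<Sum>j\<le>i. 2 / c / (real i + 1) * norm (f j))"
    proof (rule sum_norm_le)
      fix j assume "j \<in> {..i}"
      with entry[of j i] show "norm (gcesaro2_entry \<alpha> i j * f j) \<le> 2 / c / (real i + 1) * norm (f j)"
        unfolding norm_mult norm_of_real by (intro mult_right_mono) auto
    qed
    also have "\<dots> = 2 / c * ((\<Sum>j\<le>i. norm (f j)) / (real i + 1))"
      by (simp only: sum_distrib_left sum_divide_distrib times_divide_eq_left times_divide_eq_right)
    finally show ?thesis
      unfolding power_mult_distrib[symmetric] by (intro power_mono) auto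
  qed
  then have "(\<Sum>i<n. (norm (\<Sum>j\<le>i. gcesaro2_entry \<alpha> i j * f j))\<^sup>2)
      \<le> (2 / c)\<^sup>2 * (\<Sum>i<n. ((\<Sum>j\<le>i. norm (f j)) / (real i + 1))\<^sup>2)"
    unfolding sum_distrib_left by (intro sum_mono)
  also have "\<dots> \<le> (2 / c)\<^sup>2 * (4 * (\<Sum>i<n. (norm (f i))\<^sup>2))"
    by (intro mult_left_mono hardy_sum) auto
  also have "\<dots> = (4 / c)\<^sup>2 * (\<Sum>i<n. (norm (f i))\<^sup>2)"
    by (simp add: power_divide)
  finally show ?thesis by (simp add: c_def)
qed

lemma gcesaro2_square_summable:
  assumes "\<alpha> > -1"
  shows "summable (\<lambda>i. (norm (\<Sum>j\<le>i. gcesaro2_entry \<alpha> i j * Rep_ell2 f j))\<^sup>2)"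
proof (rule bounded_imp_summable)
  fix n
  have "(\<Sum>i<Suc n. (norm (\<Sum>j\<le>i. gcesaro2_entry \<alpha> i j * Rep_ell2 f j))\<^sup>2)
      \<le> (4 / min 1 (1 + \<alpha>))\<^sup>2 * (\<Sum>i<Suc n. (norm (Rep_ell2 f i))\<^sup>2)"
    by (rule gcesaro2_sum_le[OF assms])
  also have "\<dots> \<le> (4 / min 1 (1 + \<alpha>))\<^sup>2 * (norm f)\<^sup>2"
    by (intro mult_left_mono sum_le_norm_ell2) simp
  finally show "(\<Sum>i\<le>n. (norm (\<Sum>j\<le>i. gcesaro2_entry \<alpha> i j * Rep_ell2 f j))\<^sup>2)
      \<le> (4 / min 1 (1 + \<alpha>))\<^sup>2 * (norm f)\<^sup>2"
    by (simp only: lessThan_Suc_atMost)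
qed simp

lemma Rep_gcesaro2:
  assumes "\<alpha> > -1"
  shows "Rep_ell2 (gcesaro2 \<alpha> f) i = (\<Sum>j\<le>i. gcesaro2_entry \<alpha> i j * Rep_ell2 f j)"
  by (simp add: gcesaro2_def matrix_op_def gcesaro2_suminf Abs_ell2_inverse
      gcesaro2_square_summable[OF assms])

lemma bounded_clinear_gcesaro2:
  assumes "\<alpha> > -1"
  shows "bounded_clinear (gcesaro2 \<alpha>)"
  unfolding bounded_clinear_def
proof (intro conjI allI)
  show "bounded_linear (gcesaro2 \<alpha>)"
  proof (rule bounded_linear_intro)
    show "gcesaro2 \<alpha> (f + g) = gcesaro2 \<alpha> f + gcesaro2 \<alpha> g" for f g
      by (rule Rep_ell2_inject[THEN iffD1])
         (auto simp: Rep_gcesaro2[OF assms] plus_ell2.rep_eq distrib_left sum.distrib)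
    show "gcesaro2 \<alpha> (r *\<^sub>R f) = r *\<^sub>R gcesaro2 \<alpha> f" for r f
      by (rule Rep_ell2_inject[THEN iffD1])
         (auto simp: Rep_gcesaro2[OF assms] scaleR_ell2.rep_eq sum_distrib_left mult_ac)
    show "norm (gcesaro2 \<alpha> f) \<le> norm f * (4 / min 1 (1 + \<alpha>))" for f
    proof (rule power2_le_imp_le)
      show "(norm (gcesaro2 \<alpha> f))\<^sup>2 \<le> (norm f * (4 / min 1 (1 + \<alpha>)))\<^sup>2"
        unfolding norm_ell2_square[of "gcesaro2 \<alpha> f"] Rep_gcesaro2[OF assms]
      proof (rule suminf_le_const[OF gcesaro2_square_summable[OF assms]])
        fix n
        have "(\<Sum>i<n. (norm (\<Sum>j\<le>i. gcesaro2_entry \<alpha> i j * Rep_ell2 f j))\<^sup>2)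
            \<le> (4 / min 1 (1 + \<alpha>))\<^sup>2 * (\<Sum>i<n. (norm (Rep_ell2 f i))\<^sup>2)"
          by (rule gcesaro2_sum_le[OF assms])
        also have "\<dots> \<le> (4 / min 1 (1 + \<alpha>))\<^sup>2 * (norm f)\<^sup>2"
          by (intro mult_left_mono sum_le_norm_ell2) simp
        finally show "(\<Sum>i<n. (norm (\<Sum>j\<le>i. gcesaro2_entry \<alpha> i j * Rep_ell2 f j))\<^sup>2)
            \<le> (norm f * (4 / min 1 (1 + \<alpha>)))\<^sup>2"
          by (simp only: power_mult_distrib mult.commute)
      qed
    qed (use assms in \<open>simp add: min_def\<close>)
  qed
  show "gcesaro2 \<alpha> (c *\<^sub>C f) = c *\<^sub>C gcesaro2 \<alpha> f" for c f
    by (rule Rep_ell2_inject[THEN iffD1])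
       (auto simp: Rep_gcesaro2[OF assms] scaleC_ell2.rep_eq sum_distrib_left mult_ac)
qed

end

theory Submission
  imports Defs "HOL-Real_Asymp.Real_Asymp"
begin

text \<open>
  Write \<open>M = D (I - U)\<^sup>-\<^sup>2\<close> formally, with \<open>D\<close> diagonal and \<open>U\<close> the unilateral shift, and put
  \<open>s = i + \<alpha>\<close>, \<open>t = j + \<alpha>\<close>. Comparing how the \<open>(i, j)\<close> entries for \<open>i \<le> j\<close> depend on \<open>i\<close> and \<open>j\<close>
  when \<open>P\<close> and all but finitely much of \<open>Q\<close> are diagonal suggests the common value
  \<open>4 (t - s / 3 + 1) / ((t + 1) (t + 2))\<close>. Taking second differences of it, after removing the
  factors \<open>D\<close> on the side of \<open>Q\<close>, shows that \<open>Q\<close> is \<open>2 I\<close> up to a leading \<open>2 \<times> 2\<close> block with positive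
  determinant, and that \<open>P\<close> is diagonal with entries bounded above and away from \<open>0\<close>.
\<close>

section \<open>Adjoints of bounded operators on the sequence space\<close>

text \<open>As Re (-i z) = Im z, the real inner product determines the complex one; identities can
  be checked for \<open>inner\<close> and then lifted.\<close>

lemma cinner_eq_inner: "cinner x y = Complex (inner x y) (inner ((- \<i>) *\<^sub>C x) y)"
  by (simp add: complex_eq_iff Re_cinner[symmetric] cinner_scaleC_left)

lemma cinner_scaleC_right: "cinner x (c *\<^sub>C y) = cnj c * cinner x y"
  by (metis cinner_commute cinner_scaleC_left complex_cnj_mult)

lemma cinner_adjoint_of_inner:
  assumes "bounded_clinear T" "\<And>x. inner (T x) y = inner x z"
  shows "cinner (T x) y = cinner x z"
  using assms unfolding cinner_eq_inner[of "T x"] cinner_eq_inner[of x] bounded_clinear_def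
  by metis

lift_definition unit_ell2 :: "nat \<Rightarrow> ell2" is "\<lambda>j n. if n = j then 1 else 0"
  by (rule summable_finite[of "{j}" for j]) auto

lemma cinner_unit_ell2 [simp]: "cinner f (unit_ell2 j) = Rep_ell2 f j"
proof -
  have "cinner f (unit_ell2 j) = (\<Sum>n\<in>{j}. Rep_ell2 f n * cnj (if n = j then 1 else 0))"
    unfolding cinner_ell2.rep_eq unit_ell2.rep_eq by (rule suminf_finite) auto
  then show ?thesis by simp
qed

lemma cinner_unit_ell2_left [simp]: "cinner (unit_ell2 j) f = cnj (Rep_ell2 f j)"
  by (metis cinner_commute cinner_unit_ell2)

lemma Rep_ell2_sum: "Rep_ell2 (\<Sum>j\<in>A. f j) n = (\<Sum>j\<in>A. Rep_ell2 (f j) n)"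
  by (induction A rule: infinite_finite_induct)
     (simp_all add: zero_ell2.rep_eq plus_ell2.rep_eq)

lemma inner_sum_scaleC:
  "inner y (\<Sum>j\<in>A. c j *\<^sub>C g j) = (\<Sum>j\<in>A. Re (cinner y (g j) * cnj (c j)))"
  unfolding inner_sum_right
  by (simp only: Re_cinner[symmetric] cinner_scaleC_right mult.commute[of "cnj _"])

text \<open>The coefficients form an arbitrary sequence, so truncations are available before
  square-summability is known, as in \<open>adjoint_coefficients_square_summable\<close>.\<close>

definition trunc_ell2 :: "nat \<Rightarrow> (nat \<Rightarrow> complex) \<Rightarrow> ell2" where
  "trunc_ell2 n c = (\<Sum>j<n. c j *\<^sub>C unit_ell2 j)"

lemma inner_trunc_ell2: "inner f (trunc_ell2 n c) = (\<Sum>j<n. Re (Rep_ell2 f j * cnj (c j)))"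
  by (simp only: trunc_ell2_def inner_sum_scaleC cinner_unit_ell2)

lemma Rep_trunc_ell2: "Rep_ell2 (trunc_ell2 n c) i = (if i < n then c i else 0)"
proof -
  have "Rep_ell2 (trunc_ell2 n c) i = (\<Sum>j<n. if i = j then c j else 0)"
    unfolding trunc_ell2_def Rep_ell2_sum scaleC_ell2.rep_eq unit_ell2.rep_eq
    by (rule sum.cong) auto
  then show ?thesis by simp
qed

lemma norm_trunc_ell2: "(norm (trunc_ell2 n c))\<^sup>2 = (\<Sum>j<n. (norm (c j))\<^sup>2)"
  by (simp add: power2_norm_eq_inner inner_trunc_ell2 Rep_trunc_ell2 
     complex_norm_square[symmetric] flip: of_real_power)

text \<open>By Pythagoras the squared error is the squared norm of \<open>f\<close> minus a partial
  sum of its series.\<close>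

lemma trunc_ell2_tendsto: "(\<lambda>n. trunc_ell2 n (Rep_ell2 f)) \<longlonglongrightarrow> f"
proof -
  let ?s = "\<lambda>n. \<Sum>j<n. (norm (Rep_ell2 f j))\<^sup>2"
  have "(norm (trunc_ell2 n (Rep_ell2 f) - f))\<^sup>2 = (norm f)\<^sup>2 - ?s n" for n
  proof -
    have "inner f (trunc_ell2 n (Rep_ell2 f)) = ?s n"
      by (simp add: inner_trunc_ell2 complex_norm_square[symmetric] flip: of_real_power)
    then show ?thesis
      using norm_trunc_ell2[of n "Rep_ell2 f"]
      by (simp add: power2_norm_eq_inner inner_diff_left inner_diff_right inner_commute)
  qed
  moreover have "(\<lambda>n. (norm f)\<^sup>2 - ?s n) \<longlonglongrightarrow> (norm f)\<^sup>2 - (norm f)\<^sup>2"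
    unfolding norm_ell2_square by (intro tendsto_intros summable_LIMSEQ summable_ell2)
  ultimately have "(\<lambda>n. (norm (trunc_ell2 n (Rep_ell2 f) - f))\<^sup>2) \<longlonglongrightarrow> 0" by simp
  from tendsto_real_sqrt[OF this] show ?thesis
    by (subst LIM_zero_iff[symmetric], subst tendsto_norm_zero_iff[symmetric]) simp
qed

text \<open>These will be the coordinates of the adjoint at \<open>y\<close>. Testing
  \<open>T\<close> on the truncation \<open>v\<close> of the coefficient sequence itself gives
  norm(v)^2 = inner y (T v), at most norm(y) K norm(v), so norm(v) is bounded uniformly in the
  length.\<close>

lemma adjoint_coefficients_square_summable:
  fixes T :: "ell2 \<Rightarrow> ell2"
  assumes "bounded_clinear T"
  shows "summable (\<lambda>j. (norm (cinner y (T (unit_ell2 j))))\<^sup>2)"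
proof -
  define c where "c = (\<lambda>j. cinner y (T (unit_ell2 j)))"
  have lin: "bounded_linear T" and scale: "\<And>c x. T (c *\<^sub>C x) = c *\<^sub>C T x"
    using assms by (auto simp: bounded_clinear_def)
  obtain K where K: "K \<ge> 0" "\<And>x. norm (T x) \<le> norm x * K"
    using bounded_linear.nonneg_bounded[OF lin] by blast
  have bound: "(\<Sum>j<n. (norm (c j))\<^sup>2) \<le> (norm y * K)\<^sup>2" for n
  proof -
    let ?v = "trunc_ell2 n c"
    have "T ?v = (\<Sum>j<n. c j *\<^sub>C T (unit_ell2 j))"
      unfolding trunc_ell2_def linear_sum[OF bounded_linear.linear[OF lin]] scale ..
    then have "inner y (T ?v) = (\<Sum>j<n. Re (c j * cnj (c j)))"
      by (simp only: inner_sum_scaleC c_def)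
    also have "\<dots> = (norm ?v)\<^sup>2"
      by (simp add: norm_trunc_ell2 complex_norm_square[symmetric] flip: of_real_power)
    finally have "(norm ?v)\<^sup>2 \<le> norm y * (norm ?v * K)"
      using norm_cauchy_schwarz[of y "T ?v"] mult_left_mono[OF K(2)[of ?v] norm_ge_zero[of y]]
      by linarith
    then have "norm ?v \<le> norm y * K"
      using K(1) by (cases "norm ?v = 0") (simp_all add: power2_eq_square mult_ac)
    then show ?thesis unfolding norm_trunc_ell2[symmetric] by (intro power_mono) auto
  qed
  show ?thesis
    unfolding c_def[symmetric, THEN fun_cong]
    by (rule bounded_imp_summable[where B = "(norm y * K)\<^sup>2"])
       (use bound[of "Suc _"] in \<open>simp_all add: lessThan_Suc_atMost\<close>)
qed

text \<open>\<open>cadjoint\<close> is a definite description, so an adjoint has to be exhibited.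
  The coordinates of \<open>S y\<close> are forced by the values of \<open>T\<close> on unit
  vectors; the identity then holds on truncations and passes to the limit by continuity.\<close>

lemma cinner_cadjoint:
  fixes T :: "ell2 \<Rightarrow> ell2"
  assumes "bounded_clinear T"
  shows "cinner (T x) y = cinner x (cadjoint T y)"
proof -
  define S where "S = (\<lambda>y. Abs_ell2 (\<lambda>j. cinner y (T (unit_ell2 j))))"
  have Rep_S: "Rep_ell2 (S y) j = cinner y (T (unit_ell2 j))" for y j
    by (simp add: S_def Abs_ell2_inverse adjoint_coefficients_square_summable[OF assms])
  have lin: "bounded_linear T" and scale: "\<And>c x. T (c *\<^sub>C x) = c *\<^sub>C T x"
    using assms by (auto simp: bounded_clinear_def)
  have trunc: "inner (T (trunc_ell2 n c)) y = inner (trunc_ell2 n c) (S y)" for n c y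
  proof -
    have "T (trunc_ell2 n c) = (\<Sum>j<n. c j *\<^sub>C T (unit_ell2 j))"
      unfolding trunc_ell2_def linear_sum[OF bounded_linear.linear[OF lin]] scale ..
    then have "inner y (T (trunc_ell2 n c)) = inner (S y) (trunc_ell2 n c)"
      by (simp only: inner_sum_scaleC inner_trunc_ell2 Rep_S)
    then show ?thesis by (simp add: inner_commute)
  qed
  have "inner (T x) y = inner x (S y)" for x y
  proof (rule LIMSEQ_unique)
    show "(\<lambda>n. inner (T (trunc_ell2 n (Rep_ell2 x))) y) \<longlonglongrightarrow> inner (T x) y"
      by (intro tendsto_intros bounded_linear.tendsto[OF lin] trunc_ell2_tendsto)
    show "(\<lambda>n. inner (T (trunc_ell2 n (Rep_ell2 x))) y) \<longlonglongrightarrow> inner x (S y)"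
      unfolding trunc by (intro tendsto_intros trunc_ell2_tendsto)
  qed
  then have S: "cinner (T x) y = cinner x (S y)" for x y
    by (rule cinner_adjoint_of_inner[OF assms])
  from cadjoint_eqI[OF this] S show ?thesis by simp
qed

lemma ell2_eqI: "(\<And>i. Rep_ell2 f i = Rep_ell2 g i) \<Longrightarrow> f = g"
  using Rep_ell2_inject by blast

text \<open>Both products are symmetric, so it is enough to compare their matrix entries.\<close>

lemma adjoint_sandwich_eqI:
  fixes A P Q :: "ell2 \<Rightarrow> ell2"
  assumes A: "bounded_clinear A"
    and P: "\<And>x y. cinner (P x) y = cinner x (P y)" and Q: "\<And>x y. cinner (Q x) y = cinner x (Q y)"
    and entries: "\<And>i j. cinner (Q (cadjoint A (unit_ell2 j))) (cadjoint A (unit_ell2 i))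
        = cinner (P (A (unit_ell2 j))) (A (unit_ell2 i))"
  shows "A \<circ> Q \<circ> cadjoint A = cadjoint A \<circ> P \<circ> A"
proof
  note adj = cinner_cadjoint[OF A]
  have adj': "cinner (cadjoint A x) y = cinner x (A y)" for x y
    by (metis adj cinner_commute)
  have unit: "A (Q (cadjoint A (unit_ell2 i))) = cadjoint A (P (A (unit_ell2 i)))" for i
  proof (rule ell2_eqI)
    fix k
    show "Rep_ell2 (A (Q (cadjoint A (unit_ell2 i)))) k
        = Rep_ell2 (cadjoint A (P (A (unit_ell2 i)))) k"
      unfolding cinner_unit_ell2[symmetric] adj adj' by (rule entries)
  qed
  fix f
  show "(A \<circ> Q \<circ> cadjoint A) f = (cadjoint A \<circ> P \<circ> A) f"
  proof (rule ell2_eqI)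
    fix i
    \<comment> \<open>Coordinate \<open>i\<close> of the image of \<open>f\<close> is the inner
      product of \<open>f\<close> with the image of basis vector \<open>i\<close>, so agreement on
      basis vectors suffices without a limit.\<close>
    have "cinner (A (Q (cadjoint A f))) (unit_ell2 i) = cinner f (A (Q (cadjoint A (unit_ell2 i))))"
      by (simp only: adj adj' Q)
    also have "\<dots> = cinner (cadjoint A (P (A f))) (unit_ell2 i)"
      by (simp only: unit adj[symmetric] adj' P)
    finally show "Rep_ell2 ((A \<circ> Q \<circ> cadjoint A) f) i = Rep_ell2 ((cadjoint A \<circ> P \<circ> A) f) i"
      by simp
  qed
qed

text \<open>Symmetry makes the value of the form its own conjugate, so only the sign of the real
  part is left to check.\<close>

lemma positive_opI:
  assumes "bounded_clinear T" "\<And>x y. cinner (T x) y = cinner x (T y)"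
    and "\<And>f. Re (cinner (T f) f) \<ge> 0"
  shows "positive_op T"
  unfolding positive_op_def
proof (intro conjI allI)
  show "cadjoint T = T" using assms(2) by (rule cadjoint_eqI)
  fix f
  have "Im (cinner (T f) f) = 0"
    using arg_cong[OF cinner_commute[of f "T f"], of Im] assms(2)[of f f] by simp
  then show "cinner (T f) f \<in> \<real>\<^sub>\<ge>\<^sub>0"
    using assms(3)[of f] by (simp add: complex_nonneg_Reals_iff)
qed (rule assms(1))


section \<open>Diagonal operators\<close>

definition diag_ell2 :: "(nat \<Rightarrow> real) \<Rightarrow> ell2 \<Rightarrow> ell2" where
  "diag_ell2 p f = Abs_ell2 (\<lambda>n. complex_of_real (p n) * Rep_ell2 f n)"

context
  fixes p :: "nat \<Rightarrow> real" and B :: real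
  assumes p_bounded: "\<And>n. \<bar>p n\<bar> \<le> B"
begin

lemma diag_ell2_square_le:
  "(norm (complex_of_real (p n) * Rep_ell2 f n))\<^sup>2 \<le> B\<^sup>2 * (norm (Rep_ell2 f n))\<^sup>2"
  unfolding norm_mult power_mult_distrib
  by (intro mult_right_mono power_mono) (simp_all add: p_bounded)

lemma diag_ell2_square_summable:
  "summable (\<lambda>n. (norm (complex_of_real (p n) * Rep_ell2 f n))\<^sup>2)"
  by (rule summable_comparison_test'[OF summable_mult[OF summable_ell2[of f], of "B\<^sup>2"], of 0])
     (use diag_ell2_square_le in simp)

lemma Rep_diag_ell2: "Rep_ell2 (diag_ell2 p f) n = complex_of_real (p n) * Rep_ell2 f n"
  by (simp add: diag_ell2_def Abs_ell2_inverse diag_ell2_square_summable)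

lemma bounded_clinear_diag_ell2: "bounded_clinear (diag_ell2 p)"
  unfolding bounded_clinear_def
proof (intro conjI allI)
  show "bounded_linear (diag_ell2 p)"
  proof (rule bounded_linear_intro)
    show "diag_ell2 p (f + g) = diag_ell2 p f + diag_ell2 p g" for f g
      by (rule ell2_eqI) (simp add: Rep_diag_ell2 plus_ell2.rep_eq algebra_simps)
    show "diag_ell2 p (r *\<^sub>R f) = r *\<^sub>R diag_ell2 p f" for r f
      by (rule ell2_eqI) (simp add: Rep_diag_ell2 scaleR_ell2.rep_eq)
    show "norm (diag_ell2 p f) \<le> norm f * B" for f
    proof (rule power2_le_imp_le)
      have "(norm (diag_ell2 p f))\<^sup>2 \<le> (\<Sum>n. B\<^sup>2 * (norm (Rep_ell2 f n))\<^sup>2)"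
        unfolding norm_ell2_square Rep_diag_ell2
        by (intro suminf_le diag_ell2_square_summable summable_mult summable_ell2 
            diag_ell2_square_le)
      also have "\<dots> = (norm f * B)\<^sup>2"
        by (simp add: suminf_mult summable_ell2 norm_ell2_square power_mult_distrib)
      finally show "(norm (diag_ell2 p f))\<^sup>2 \<le> (norm f * B)\<^sup>2" .
      show "0 \<le> norm f * B" using p_bounded[of 0] by simp
    qed
  qed
  show "diag_ell2 p (c *\<^sub>C f) = c *\<^sub>C diag_ell2 p f" for c f
    by (rule ell2_eqI) (simp add: Rep_diag_ell2 scaleC_ell2.rep_eq)
qed

lemma cinner_diag_ell2: "cinner (diag_ell2 p x) y = cinner x (diag_ell2 p y)"
  by (simp add: cinner_ell2.rep_eq Rep_diag_ell2 mult_ac)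

lemma positive_diag_ell2:
  assumes "\<And>n. p n \<ge> 0"
  shows "positive_op (diag_ell2 p)"
proof (rule positive_opI[OF bounded_clinear_diag_ell2 cinner_diag_ell2])
  fix f
  have "cinner (diag_ell2 p f) f = (\<Sum>n. complex_of_real (p n * (norm (Rep_ell2 f n))\<^sup>2))"
    by (simp add: cinner_ell2.rep_eq Rep_diag_ell2 mult.assoc complex_norm_square
        del: of_real_power)
  moreover have sm: "summable (\<lambda>n. p n * (norm (Rep_ell2 f n))\<^sup>2)"
    using p_bounded assms
    by (intro summable_comparison_test'[OF summable_mult[OF summable_ell2[of f], of B], of 0])
       (auto intro!: mult_right_mono simp: abs_mult)
  moreover have "(\<Sum>n. complex_of_real (p n * (norm (Rep_ell2 f n))\<^sup>2))
      = complex_of_real (\<Sum>n. p n * (norm (Rep_ell2 f n))\<^sup>2)"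
    by (rule suminf_of_real[OF sm, symmetric])
  ultimately have "Re (cinner (diag_ell2 p f) f) = (\<Sum>n. p n * (norm (Rep_ell2 f n))\<^sup>2)"
    by (simp only: Re_complex_of_real)
  also have "\<dots> \<ge> 0" by (intro suminf_nonneg sm) (simp add: assms)
  finally show "Re (cinner (diag_ell2 p f) f) \<ge> 0" .
qed

end

text \<open>The reciprocals give a bounded right inverse, so the operator is even onto.\<close>

lemma dense_range_diag_ell2:
  assumes p: "\<And>n. \<bar>p n\<bar> \<le> B" and inv: "\<And>n. \<bar>1 / p n\<bar> \<le> C" and "\<And>n. p n \<noteq> 0"
  shows "dense_range (diag_ell2 p)"
proof -
  have "diag_ell2 p (diag_ell2 (\<lambda>n. 1 / p n) f) = f" for f
    by (rule ell2_eqI)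
      (simp add: Rep_diag_ell2[OF p] Rep_diag_ell2[of "\<lambda>n. 1 / p n", OF inv] assms(3))
  then have "range (diag_ell2 p) = UNIV" by (rule surjI)
  then show ?thesis by (simp add: dense_range_def)
qed


section \<open>Modifying twice the identity in the leading two-by-two block\<close>

text \<open>Writing the block with rows (a, b) and (b, c) as a finite-rank correction of 2 I reduces
  norms and inner products to those of \<open>f\<close> and two unit vectors.\<close>

definition block_ell2 :: "real \<Rightarrow> real \<Rightarrow> real \<Rightarrow> ell2 \<Rightarrow> ell2" where
  "block_ell2 a b c f = 2 *\<^sub>R f
     + ((a - 2) * Rep_ell2 f 0 + b * Rep_ell2 f 1) *\<^sub>C unit_ell2 0
     + (b * Rep_ell2 f 0 + (c - 2) * Rep_ell2 f 1) *\<^sub>C unit_ell2 1"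

lemma cinner_block_ell2:
  "cinner (block_ell2 a b c f) g = 2 * cinner f g
     + ((a - 2) * Rep_ell2 f 0 + b * Rep_ell2 f 1) * cnj (Rep_ell2 g 0)
     + (b * Rep_ell2 f 0 + (c - 2) * Rep_ell2 f 1) * cnj (Rep_ell2 g 1)"
  by (simp add: block_ell2_def cinner_add_left cinner_scaleC_left flip: scaleC_of_real)

lemma cinner_block_ell2_symmetric: "cinner (block_ell2 a b c x) y = cinner x (block_ell2 a b c y)"
  using cinner_commute[of x y]
  unfolding cinner_commute[of x "block_ell2 a b c y"] cinner_block_ell2
  by (simp add: algebra_simps)

lemma bounded_clinear_block_ell2: "bounded_clinear (block_ell2 a b c)"
  unfolding bounded_clinear_def
proof (intro conjI allI)
  let ?K = "2 + (\<bar>a - 2\<bar> + \<bar>b\<bar>) + (\<bar>b\<bar> + \<bar>c - 2\<bar>)"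
  have norm_unit: "norm (z *\<^sub>C unit_ell2 j) = norm z" for z j
  proof -
    have "(norm (z *\<^sub>C unit_ell2 j))\<^sup>2 = (norm z)\<^sup>2"
      unfolding power2_norm_eq_inner[of "z *\<^sub>C unit_ell2 j"] Re_cinner[symmetric]
        cinner_scaleC_left cinner_scaleC_right cinner_unit_ell2 
      by (simp add: scaleC_ell2.rep_eq unit_ell2.rep_eq cmod_power2 flip: power2_eq_square)
    then show ?thesis by simp
  qed
  show "bounded_linear (block_ell2 a b c)"
  proof (rule bounded_linear_intro)
    show "block_ell2 a b c (f + g) = block_ell2 a b c f + block_ell2 a b c g" for f g
      by (rule ell2_eqI) (simp add: block_ell2_def plus_ell2.rep_eq scaleR_ell2.rep_eq
          scaleC_ell2.rep_eq algebra_simps)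
    show "block_ell2 a b c (r *\<^sub>R f) = r *\<^sub>R block_ell2 a b c f" for r f
      by (rule ell2_eqI) (simp add: block_ell2_def plus_ell2.rep_eq scaleR_ell2.rep_eq
          scaleC_ell2.rep_eq algebra_simps)
    fix f
    have coord: "norm (complex_of_real r * Rep_ell2 f 0 + complex_of_real s * Rep_ell2 f 1)
        \<le> norm f * (\<bar>r\<bar> + \<bar>s\<bar>)" for r s
    proof -
      have "norm (complex_of_real r * Rep_ell2 f 0 + complex_of_real s * Rep_ell2 f 1)
          \<le> \<bar>r\<bar> * norm (Rep_ell2 f 0) + \<bar>s\<bar> * norm (Rep_ell2 f 1)"
        by (rule norm_triangle_le) (simp add: norm_mult)
      also have "\<dots> \<le> \<bar>r\<bar> * norm f + \<bar>s\<bar> * norm f"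
        by (intro add_mono mult_left_mono coord_le_norm_ell2) auto
      finally show ?thesis by (simp add: algebra_simps)
    qed
    have "norm (block_ell2 a b c f) \<le> norm f * 2 + norm f * (\<bar>a - 2\<bar> + \<bar>b\<bar>) + norm f * (\<bar>b\<bar> + \<bar>c - 2\<bar>)"
      unfolding block_ell2_def
      by (intro order_trans[OF norm_triangle_ineq] add_mono)
         (use coord[of "a - 2" b] coord[of b "c - 2"] in \<open>simp_all add: norm_unit\<close>)
    then show "norm (block_ell2 a b c f) \<le> norm f * ?K" unfolding distrib_left .
  qed
  show "block_ell2 a b c (z *\<^sub>C f) = z *\<^sub>C block_ell2 a b c f" for z f
    by (rule ell2_eqI) (simp add: block_ell2_def plus_ell2.rep_eq scaleR_ell2.rep_eq
        scaleC_ell2.rep_eq algebra_simps)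
qed

text \<open>Multiply by \<open>a\<close> and complete the square.\<close>

lemma quadratic_form_nonneg:
  fixes a b c u v :: real
  assumes "a > 0" "b\<^sup>2 \<le> a * c"
  shows "a * u\<^sup>2 + 2 * b * (u * v) + c * v\<^sup>2 \<ge> 0"
proof -
  have "a * (a * u\<^sup>2 + 2 * b * (u * v) + c * v\<^sup>2) = (a * u + b * v)\<^sup>2 + (a * c - b\<^sup>2) * v\<^sup>2"
    by (simp add: power2_eq_square algebra_simps)
  also have "\<dots> \<ge> 0" using assms(2) by simp
  finally show ?thesis using assms(1) by (simp add: zero_le_mult_iff)
qed

text \<open>Since a, b, c are real, the form of the block splits into one copy for the real parts
  and one for the imaginary parts of the first two coordinates. The rest is twice the squared norm
  of the remaining coordinates.\<close>

lemma positive_block_ell2: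
  assumes "a > 0" "b\<^sup>2 \<le> a * c"
  shows "positive_op (block_ell2 a b c)"
proof (rule positive_opI[OF bounded_clinear_block_ell2 cinner_block_ell2_symmetric])
  fix f
  obtain x y where 0: "Rep_ell2 f 0 = Complex x y" by (cases "Rep_ell2 f 0")
  obtain z w where 1: "Rep_ell2 f 1 = Complex z w" by (cases "Rep_ell2 f 1")
  have "x\<^sup>2 + y\<^sup>2 + (z\<^sup>2 + w\<^sup>2) \<le> (norm f)\<^sup>2"
    using sum_le_norm_ell2[of f 2] by (simp add: lessThan_Suc numeral_2_eq_2 0 1[simplified] cmod_def add_ac)
  moreover have "Re (cinner (block_ell2 a b c f) f) = 2 * ((norm f)\<^sup>2 - (x\<^sup>2 + y\<^sup>2 + (z\<^sup>2 + w\<^sup>2)))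
      + (a * x\<^sup>2 + 2 * b * (x * z) + c * z\<^sup>2) + (a * y\<^sup>2 + 2 * b * (y * w) + c * w\<^sup>2)"
    unfolding cinner_block_ell2 0 1
    by (simp add: Re_cinner power2_eq_square[of "_ :: real"] algebra_simps)
       (simp add: power2_norm_eq_inner[symmetric] power2_eq_square)
  ultimately show "Re (cinner (block_ell2 a b c f) f) \<ge> 0"
    using quadratic_form_nonneg[OF assms, of x z] quadratic_form_nonneg[OF assms, of y w] by simp
qed


section \<open>The two Gram matrices of the Cesaro matrix\<close>

text \<open>For d = j - i these are the products of numerators of rows i and j, up to the constant
  4. Reversing the summation leaves sums of squares and of consecutive integers.\<close>

lemma sum_shifted_products:
  fixes d :: real
  shows "(\<Sum>k\<le>i. (real i + 1 - real k) * (real i + 1 - real k + d))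
    = (real i + 1) * (real i + 2) * (2 * real i + 3) / 6 + d * (real i + 1) * (real i + 2) / 2"
proof -
  have "(\<Sum>k\<le>i. (real i + 1 - real k) * (real i + 1 - real k + d))
      = (\<Sum>k\<le>i. (real k + 1) * (real k + 1 + d))"
    by (rule sum.reindex_bij_witness[of _ "\<lambda>k. i - k" "\<lambda>k. i - k"]) (auto simp: of_nat_diff algebra_simps)
  also have "\<dots> = (real i + 1) * (real i + 2) * (2 * real i + 3) / 6
      + d * (real i + 1) * (real i + 2) / 2"
    by (induction i) (simp_all add: field_simps)
  finally show ?thesis .
qed

text \<open>The numbers \<open>a\<close>, \<open>b\<close>, \<open>c\<close> are the second differences in both indices at the corner of the kernel
  \<open>(s + 1) (s + 2) (t - s / 3 + 1)\<close>, extended by \<open>0\<close> to negative indices.\<close>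

lemma row_gram:
  fixes \<alpha> :: real
  defines "m \<equiv> gcesaro2_entry \<alpha>"
  defines "a \<equiv> (\<alpha> + 1) * (\<alpha> + 2) * (2 * \<alpha> + 3) / 3"
    and "b \<equiv> - 2 * \<alpha> * (\<alpha> + 1) * (\<alpha> + 2) / 3"
    and "c \<equiv> (\<alpha> + 2) * (2 * \<alpha>\<^sup>2 - \<alpha> + 3) / 3"
  assumes "\<alpha> > -1" "i \<le> j"
  shows "2 * (\<Sum>k\<le>i. m i k * m j k) + ((a - 2) * m i 0 + b * m i 1) * m j 0
      + (b * m i 0 + (c - 2) * m i 1) * m j 1
    = 4 * (real j + \<alpha> - (real i + \<alpha>) / 3 + 1) / ((real j + 1 + \<alpha>) * (real j + 2 + \<alpha>))"
proof -
  define e where "e = (\<lambda>n. (real n + 1 + \<alpha>) * (real n + 2 + \<alpha>))"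
  define x where "x = real i"
  define y where "y = real j"
  have pos: "e n > 0" for n using assms by (simp add: e_def)
  have m: "m n k = 2 * (real n + 1 - real k) / e n" if "k \<le> n" for n k
    using that by (simp add: m_def gcesaro2_entry_def e_def)
  have m0: "m n 0 = 2 * (real n + 1) / e n" for n by (simp add: m)
  \<comment> \<open>Entry (0, 1) lies above the diagonal, but the formula also gives 0 there, so i =
    0 is no special case.\<close>
  have m1: "m n 1 = 2 * real n / e n" for n
    by (cases "n = 0") (simp_all add: m_def gcesaro2_entry_def e_def)
  have "(\<Sum>k\<le>i. m i k * m j k)
      = (\<Sum>k\<le>i. 4 / (e i * e j) * ((real i + 1 - real k) * (real i + 1 - real k + (real j - real i))))"
    using \<open>i \<le> j\<close> by (intro sum.cong) (auto simp: m add_divide_distrib diff_divide_distrib algebra_simps)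
  also have "\<dots> = 4 / (e i * e j) *
      ((x + 1) * (x + 2) * (2 * x + 3) / 6 + (y - x) * (x + 1) * (x + 2) / 2)"
    by (simp only: sum_distrib_left[symmetric] sum_shifted_products x_def y_def)
  finally have S: "(\<Sum>k\<le>i. m i k * m j k) = \<dots>" .
  have "2 * (\<Sum>k\<le>i. m i k * m j k) + ((a - 2) * m i 0 + b * m i 1) * m j 0
      + (b * m i 0 + (c - 2) * m i 1) * m j 1
    = 4 / (e i * e j) * (2 * ((x + 1) * (x + 2) * (2 * x + 3) / 6 + (y - x) * (x + 1) * (x + 2) / 2)
        + ((a - 2) * (x + 1) + b * x) * (y + 1) + (b * (x + 1) + (c - 2) * x) * y)"
    unfolding S m0 m1 x_def[symmetric] y_def[symmetric] using pos[of i] pos[of j]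
    by (simp add: field_simps)
  \<comment> \<open>The choice of a, b, c makes the factor \<open>e i\<close> split off this
    polynomial, which cancels the denominator depending on \<open>i\<close>.\<close>
  also have "(2 * ((x + 1) * (x + 2) * (2 * x + 3) / 6 + (y - x) * (x + 1) * (x + 2) / 2)
        + ((a - 2) * (x + 1) + b * x) * (y + 1) + (b * (x + 1) + (c - 2) * x) * y)
      = (x + 1 + \<alpha>) * (x + 2 + \<alpha>) * (y + \<alpha> - (x + \<alpha>) / 3 + 1)"
    unfolding a_def b_def c_def by (simp add: field_simps power2_eq_square)
  also have "(x + 1 + \<alpha>) * (x + 2 + \<alpha>) = e i" by (simp add: e_def x_def)
  also have "4 / (e i * e j) * (e i * (y + \<alpha> - (x + \<alpha>) / 3 + 1))
      = 4 * (y + \<alpha> - (x + \<alpha>) / 3 + 1) / e j"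
    using pos[of i] by simp
  finally show ?thesis unfolding x_def y_def e_def .
qed

text \<open>Expand (u - s)(u - t) = u(u + 1) - (s + t + 1) u + s t. Each term cancels against u(u +
  1)(u + 2)(u + 3) to a reciprocal product of two, three or four consecutive factors, which
  telescopes; this is the source of the divisors 1, 2, 3 in \<open>F\<close>.\<close>

lemma rational_telescope:
  fixes u s t :: real
  assumes "u > 0"
  defines "F \<equiv> \<lambda>u. 8 * (1 / (u + 2) - (s + t + 1) / (2 * (u + 1) * (u + 2))
    + s * t / (3 * u * (u + 1) * (u + 2)))"
  shows "F u - F (u + 1) = 8 * (u - s) * (u - t) / (u * (u + 1) * (u + 2) * (u + 3))"
proof -
  have "u \<noteq> 0" "u + 1 \<noteq> 0" "u + 2 \<noteq> 0" "u + 3 \<noteq> 0" using assms by auto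
  moreover have "u + 1 + 1 = u + 2" "u + 1 + 2 = u + 3" by auto
  ultimately show ?thesis unfolding F_def
    by (simp add: divide_simps) (simp add: algebra_simps)
qed

text \<open>With u = k + 1 + \<alpha>, the weight \<open>p k\<close> turns the squared denominator
  u^2 (u + 1)^2 into u(u + 1)(u + 2)(u + 3), so that the series telescopes.\<close>

lemma column_gram:
  fixes \<alpha> :: real
  defines "m \<equiv> gcesaro2_entry \<alpha>"
  defines "p \<equiv> \<lambda>n. 2 * (real n + 1 + \<alpha>) * (real n + 2 + \<alpha>) / ((real n + 3 + \<alpha>) * (real n + 4 + \<alpha>))"
  assumes "\<alpha> > -1" "i \<le> j"
  shows "(\<lambda>k. p k * m k i * m k j) sums
    (4 * (real j + \<alpha> - (real i + \<alpha>) / 3 + 1) / ((real j + 1 + \<alpha>) * (real j + 2 + \<alpha>)))"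
proof -
  define s where "s = real i + \<alpha>"
  define t where "t = real j + \<alpha>"
  define F where "F = (\<lambda>u. 8 * (1 / (u + 2) - (s + t + 1) / (2 * (u + 1) * (u + 2))
    + s * t / (3 * u * (u + 1) * (u + 2))))"
  have "t > -1" using assms by (simp add: t_def)
  \<comment> \<open>Column \<open>j\<close> vanishes above the diagonal, so the series starts at k =
    j, that is at u = t + 1.\<close>
  have terms: "p (n + j) * m (n + j) i * m (n + j) j = F (real n + t + 1) - F (real (Suc n) + t + 1)" for n
  proof -
    define u where "u = real n + t + 1"
    have u: "u > 0" using \<open>t > -1\<close> by (simp add: u_def)
    have "real (n + j) + 1 + \<alpha> = u" "real (n + j) + 2 + \<alpha> = u + 1" "real (n + j) + 3 + \<alpha> = u + 2"
      "real (n + j) + 4 + \<alpha> = u + 3" "real (n + j) + 1 - real i = u - s"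
      "real (n + j) + 1 - real j = u - t"
      by (simp_all add: u_def s_def t_def)
    note u_eq = this
    have "p (n + j) * m (n + j) i * m (n + j) j
        = 2 * u * (u + 1) / ((u + 2) * (u + 3)) * (2 * (u - s) / (u * (u + 1))) * (2 * (u - t) / (u * (u + 1)))"
      using \<open>i \<le> j\<close> unfolding p_def m_def gcesaro2_entry_def u_eq by simp
    also have "\<dots> = 8 * (u - s) * (u - t) / (u * (u + 1) * (u + 2) * (u + 3))"
      using u by (simp add: divide_simps) (simp add: algebra_simps)
    also have "\<dots> = F u - F (u + 1)"
      unfolding F_def by (rule rational_telescope[OF u, symmetric])
    finally show ?thesis by (simp add: u_def add_ac)
  qed
  have "(\<lambda>n. F (real n + t + 1)) \<longlonglongrightarrow> 0"
    unfolding F_def by real_asymp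
  from telescope_sums'[OF this]
  have "(\<lambda>n. p (n + j) * m (n + j) i * m (n + j) j) sums F (t + 1)"
    unfolding terms by simp
  moreover have "p k * m k i * m k j = 0" if "k < j" for k
    using that by (simp add: m_def gcesaro2_entry_def)
  ultimately have "(\<lambda>k. p k * m k i * m k j) sums F (t + 1)"
    by (subst sums_zero_iff_shift[symmetric, of j]) auto
  \<comment> \<open>Over the common denominator (t + 1)(t + 2)(t + 3) the factor t + 3 cancels,
    leaving the value in \<open>row_gram\<close>.\<close>
  also have "F (t + 1) = 4 * (t - s / 3 + 1) / ((t + 1) * (t + 2))"
  proof -
    have "t + 1 \<noteq> 0" "t + 2 \<noteq> 0" "t + 3 \<noteq> 0" "t + 1 + 1 = t + 2" "t + 1 + 2 = t + 3"
      using \<open>t > -1\<close> by auto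
    then show ?thesis unfolding F_def by (simp add: divide_simps) (simp add: algebra_simps)
  qed
  finally show ?thesis by (simp add: s_def t_def add_ac)
qed

section \<open>Matrix entries of the operator and its adjoint, and the conclusion\<close>

lemma Rep_gcesaro2_unit:
  assumes "\<alpha> > -1"
  shows "Rep_ell2 (gcesaro2 \<alpha> (unit_ell2 j)) i = gcesaro2_entry \<alpha> i j"
proof -
  have "Rep_ell2 (gcesaro2 \<alpha> (unit_ell2 j)) i = (\<Sum>k\<le>i. if k = j then gcesaro2_entry \<alpha> i k else 0)"
    unfolding Rep_gcesaro2[OF assms] unit_ell2.rep_eq of_real_sum by (rule sum.cong) auto
  then show ?thesis by (simp add: gcesaro2_entry_def)
qed

lemma Rep_cadjoint_gcesaro2_unit:
  assumes "\<alpha> > -1"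
  shows "Rep_ell2 (cadjoint (gcesaro2 \<alpha>) (unit_ell2 i)) j = gcesaro2_entry \<alpha> i j"
  using cinner_cadjoint[OF bounded_clinear_gcesaro2[OF assms], of "unit_ell2 j" "unit_ell2 i"]
  by (simp add: Rep_gcesaro2_unit[OF assms] complex_eq_iff)

theorem theorem2p1:
  fixes \<alpha> :: real
  assumes "\<alpha> > -1"
  shows "supraposinormal (gcesaro2 \<alpha>)"
proof -
  let ?m = "gcesaro2_entry \<alpha>" and ?A = "gcesaro2 \<alpha>"
  define p where "p = (\<lambda>n. 2 * (real n + 1 + \<alpha>) * (real n + 2 + \<alpha>) / ((real n + 3 + \<alpha>) * (real n + 4 + \<alpha>)))"
  define a where "a = (\<alpha> + 1) * (\<alpha> + 2) * (2 * \<alpha> + 3) / 3"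
  define b where "b = - 2 * \<alpha> * (\<alpha> + 1) * (\<alpha> + 2) / 3"
  define c where "c = (\<alpha> + 2) * (2 * \<alpha>\<^sup>2 - \<alpha> + 3) / 3"
  define P where "P = diag_ell2 p"
  define Q where "Q = block_ell2 a b c"
  note A = bounded_clinear_gcesaro2[OF assms]
  have p_pos: "p n > 0" for n using assms by (simp add: p_def)
  have p_le: "\<bar>p n\<bar> \<le> 2" for n
  proof -
    have "(real n + 1 + \<alpha>) * (real n + 2 + \<alpha>) \<le> (real n + 3 + \<alpha>) * (real n + 4 + \<alpha>)"
      using assms by (intro mult_mono) auto
    then have "p n \<le> 2" using assms unfolding p_def mult.assoc[of 2] by (subst pos_divide_le_eq) auto
    then show ?thesis using p_pos[of n] by simp
  qed
  \<comment> \<open>Each factor of 1 / p n has the form 1 + 2 / v with v increasing in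
    \<open>n\<close>, so the bound is the value at n = 0, finite since \<alpha> > -1.\<close>
  have p_inv: "\<bar>1 / p n\<bar> \<le> (1 + 2 / (1 + \<alpha>)) * (1 + 2 / (2 + \<alpha>)) / 2" for n
  proof -
    have "1 / p n = (1 + 2 / (real n + 1 + \<alpha>)) * (1 + 2 / (real n + 2 + \<alpha>)) / 2"
      using assms by (simp add: p_def divide_simps) (simp add: algebra_simps)
    also have "\<dots> \<le> (1 + 2 / (1 + \<alpha>)) * (1 + 2 / (2 + \<alpha>)) / 2"
      using assms by (intro divide_right_mono mult_mono add_mono divide_left_mono) auto
    finally show ?thesis using p_pos[of n] by simp
  qed
  have a_pos: "a > 0" using assms by (simp add: a_def)
  have "a * c - b\<^sup>2 = (\<alpha> + 1) * (\<alpha> + 2)\<^sup>2 * (\<alpha> + 3) / 3"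
    by (simp add: a_def b_def c_def field_simps power2_eq_square)
  moreover have "\<dots> \<ge> 0" using assms by simp
  ultimately have det: "b\<^sup>2 \<le> a * c" by simp
  \<comment> \<open>The adjoint sends unit vector \<open>j\<close> to row \<open>j\<close> and the
    operator sends it to column \<open>j\<close>, so the two sides are the Gram entries of
    \<open>row_gram\<close> and \<open>column_gram\<close>, with the smaller index now called
    \<open>j\<close>.\<close>
  have entries: "cinner (Q (cadjoint ?A (unit_ell2 j))) (cadjoint ?A (unit_ell2 i))
      = cinner (P (?A (unit_ell2 j))) (?A (unit_ell2 i))" if "j \<le> i" for i j
  proof -
    have "cinner (cadjoint ?A (unit_ell2 j)) (cadjoint ?A (unit_ell2 i)) = (\<Sum>k\<le>j. complex_of_real (?m j k * ?m i k))"
      unfolding cinner_ell2.rep_eq Rep_cadjoint_gcesaro2_unit[OF assms] complex_cnj_complex_of_real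
        of_real_mult
      by (rule suminf_finite) (auto simp: gcesaro2_entry_def)
    then have "cinner (Q (cadjoint ?A (unit_ell2 j))) (cadjoint ?A (unit_ell2 i))
        = complex_of_real (2 * (\<Sum>k\<le>j. ?m j k * ?m i k)
          + ((a - 2) * ?m j 0 + b * ?m j 1) * ?m i 0 + (b * ?m j 0 + (c - 2) * ?m j 1) * ?m i 1)"
      by (simp add: Q_def cinner_block_ell2 Rep_cadjoint_gcesaro2_unit[OF assms])
    also have "\<dots> = complex_of_real (\<Sum>k. p k * ?m k j * ?m k i)"
      unfolding a_def b_def c_def row_gram[OF assms that] p_def
      using sums_unique[OF column_gram[OF assms that]] by simp
    also have "\<dots> = (\<Sum>k. complex_of_real (p k * ?m k j * ?m k i))"
      using sums_summable[OF column_gram[OF assms that]] 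
      by (intro suminf_of_real) (simp add: p_def)
    also have "\<dots> = cinner (P (?A (unit_ell2 j))) (?A (unit_ell2 i))"
      by (simp add: cinner_ell2.rep_eq P_def Rep_diag_ell2[of p, OF p_le] Rep_gcesaro2_unit[OF assms])
    finally show ?thesis .
  qed
  have P_sym: "cinner (P x) y = cinner x (P y)" for x y
    unfolding P_def using p_le by (rule cinner_diag_ell2)
  have Q_sym: "cinner (Q x) y = cinner x (Q y)" for x y
    unfolding Q_def by (rule cinner_block_ell2_symmetric)
  \<comment> \<open>The case i < j follows by conjugation, as both matrices are Hermitian.\<close>
  have "cinner (Q (cadjoint ?A (unit_ell2 j))) (cadjoint ?A (unit_ell2 i))
      = cinner (P (?A (unit_ell2 j))) (?A (unit_ell2 i))" for i j
    using entries[of i j] entries[of j i] by (metis P_sym Q_sym cinner_commute linear)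
  then have "?A \<circ> Q \<circ> cadjoint ?A = cadjoint ?A \<circ> P \<circ> ?A"
    by (rule adjoint_sandwich_eqI[OF A P_sym Q_sym])
  moreover have "positive_op P"
    unfolding P_def using p_le by (rule positive_diag_ell2) (simp add: p_pos less_imp_le)
  moreover have "positive_op Q"
    unfolding Q_def using a_pos det by (rule positive_block_ell2)
  moreover have "dense_range P"
    unfolding P_def using p_le p_inv by (rule dense_range_diag_ell2) (metis p_pos less_irrefl)
  ultimately show ?thesis using A unfolding supraposinormal_def by blast
qed

end
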